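(* Let $(L^J)_{J\in\mathbb N_0}$ be L\'evy's approximations and $W=\lim_{J\to\infty}L^J$ the Brownian motion on $[0,1]$ obtained as their $\mathbb P$-a.s. uniform limit (see context). Then for all $J\in\mathbb N$ $$\mathbb E\big[\|L^J-W\|_\infty^2\big]^{1/2}\le C_a\cdot c_{\min\{J,4\}}\cdot\sqrt{J+1}\cdot 2^{-J/2},$$ where $C_a=\sqrt{\tfrac{2}{\ln 2}}\big(1+\tfrac{1}{2\ln 2}\big)\approx 2.9240$, $c_1\approx1.7338$, $c_2\approx1.3721$, $c_3\approx1.1906$ are the constants given in the context and $$c_4=\sqrt{1+\frac{1}{8(\ln 2)^{5/2}}\Big(\frac14+\frac{3}{16\ln 2}\Big)}\approx1.0783.$$
   Context: $\|\cdot\|_\infty$ is the supremum norm on $[0,1]$. L\'evy's construction: let $H(t):=2t\,\mathbf 1_{[0,1/2]}(t)+2(1-t)\,\mathbf 1_{(1/2,1]}(t)$, $H_0(t):=t$, and for $n=2^j+k\ge 1$ with $j\in\mathbb N_0$, $k\in\{0,\dots,2^j-1\}$ put $H_n(t):=H(2^jt-k)$, $t\in[0,1]$. Let $\lambda_0:=1$ and $\lambda_n:=2^{-\lfloor\log_2 n\rfloor/2-1}$ for $n\ge 1$. Let $(Z_n)_{n\in\mathbb N_0}$ be i.i.d. standard normal random variables. For $J\in\mathbb N_0$ put $L^J_t:=\sum_{n=0}^{2^J-1}\lambda_nZ_nH_n(t)$. The sequence $L^J$ converges $\mathbb P$-a.s. uniformly on $[0,1]$ to a standard Brownian motion $W$.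 For $J\in\{1,2,3\}$ the constant $c_J$ is given by $c_J^2=\inf_{\alpha>0}\Big\{1+\alpha+\frac{2}{(1+\alpha)^{1/2}(\ln 2)^{5/2}}\Big(\frac{1}{(1+\alpha)J}+\frac{3}{2\ln 2\,((1+\alpha)J)^{3/2}}\Big)2^{-(1+\alpha)J}\Big\}$, with approximate values $c_1^2\approx3.0059$, $c_2^2\approx1.8826$, $c_3^2\approx1.4176$. *)

theory Defs
  imports "HOL-Probability.Probability"
begin

definition hat :: "real \<Rightarrow> real" where
  "hat t = 2 * t * indicator {0..1/2} t + 2 * (1 - t) * indicator {1/2<..1} t"

definition levy_level :: "nat \<Rightarrow> nat" where
  "levy_level n = nat \<lfloor>log 2 (real n)\<rfloor>"

(* For n \<ge> 1, j = levy_level n and k = n - 2 ^ j are the unique naturals with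
   n = 2 ^ j + k and k < 2 ^ j. *)
definition schauder :: "nat \<Rightarrow> real \<Rightarrow> real" where
  "schauder n t =
    (if n = 0 then t
     else (let j = levy_level n; k = n - 2 ^ j in hat (2 ^ j * t - real k)))"

definition levy_coeff :: "nat \<Rightarrow> real" where
  "levy_coeff n = (if n = 0 then 1 else 2 powr (- real (levy_level n) / 2 - 1))"

definition levy_approx :: "(nat \<Rightarrow> 'a \<Rightarrow> real) \<Rightarrow> nat \<Rightarrow> real \<Rightarrow> 'a \<Rightarrow> real" where
  "levy_approx Z J t \<omega> = (\<Sum>n<2 ^ J. levy_coeff n * Z n \<omega> * schauder n t)"

(* Valued in ennreal, so that the supremum of an unbounded function is \<infinity>;
   a real-valued SUP would be unspecified there. *)
definition sup_norm01 :: "(real \<Rightarrow> real) \<Rightarrow> ennreal" where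
  "sup_norm01 f = (SUP t\<in>{0..1}. ennreal \<bar>f t\<bar>)"

definition C_a :: real where
  "C_a = sqrt (2 / ln 2) * (1 + 1 / (2 * ln 2))"

(* Only the indices 1, 2, 3 and 4 are meaningful. *)
definition levy_const :: "nat \<Rightarrow> real" where
  "levy_const J =
    (if J = 4 then sqrt (1 + 1 / (8 * ln 2 powr (5/2)) * (1/4 + 3 / (16 * ln 2)))
     else sqrt (INF \<alpha>\<in>{0<..}.
       1 + \<alpha> + 2 / ((1 + \<alpha>) powr (1/2) * ln 2 powr (5/2))
         * (1 / ((1 + \<alpha>) * real J) + 3 / (2 * ln 2 * ((1 + \<alpha>) * real J) powr (3/2)))
         * 2 powr (- (1 + \<alpha>) * real J)))"

end

(* Write r = 1 / sqrt 2 and q = 1 / (1 - r). The tent functions of one dyadic level have disjoint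
   supports, so the level-j increment of Levy's series is at most r ^ j / 2 times the maximum of |Z_n|
   over the 2 ^ j indices n of that level. Cauchy-Schwarz against the weights r ^ j / 2 bounds the square
   of the tail from level J on by (r ^ J * q / 2) times the sum of r ^ j / 2 * max (Z_n)^2, and
   E exp (3/8 Z^2) = 2 together with ln y <= y / c - 1 + ln c gives E max (Z_n)^2 <= 8/3 * ln 2 * (j + 1).
   Summing up, the mean square error is at most 2/3 * ln 2 * q^2 * (J + q) * 2 ^ (-J). Since this is
   smaller than the bound of the paper, crude lower bounds on the constants c_J suffice. *)

theory Submission
  imports Defs
begin

section \<open>Schauder functions of one level\<close>

lemma hat_nonneg: "0 \<le> hat t"
  unfolding hat_def by (auto simp: indicator_def)

text \<open>The right end can be left out because \<open>hat\<close> vanishes at 1. Half-open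
  supports make integer translates exactly disjoint.\<close>

lemma hat_le_of_bool: "hat t \<le> of_bool (0 \<le> t \<and> t < 1)"
  unfolding hat_def by (auto simp: indicator_def)

lemma sum_hat_shift_le_1:
  assumes "finite K"
  shows "(\<Sum>k\<in>K. hat (s - real k)) \<le> 1"
proof -
  \<comment> \<open>For negative \<open>s\<close> the index \<open>nat \<lfloor>s\<rfloor>\<close>
    is 0. This does no harm: every summand on the left is then 0.\<close>
  have "(\<Sum>k\<in>K. hat (s - real k)) \<le> (\<Sum>k\<in>K. if k = nat \<lfloor>s\<rfloor> then 1 else 0)"
  proof (rule sum_mono)
    fix k
    have "k = nat \<lfloor>s\<rfloor>" if "0 \<le> s - real k" "s - real k < 1"
    proof -
      have "\<lfloor>s\<rfloor> = int k" using that by (intro floor_unique) auto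
      then show ?thesis by simp
    qed
    then have "of_bool (0 \<le> s - real k \<and> s - real k < 1) \<le> (if k = nat \<lfloor>s\<rfloor> then 1 else 0 :: real)"
      by auto
    with hat_le_of_bool show "hat (s - real k) \<le> (if k = nat \<lfloor>s\<rfloor> then 1 else 0)"
      by (rule order_trans)
  qed
  also have "\<dots> \<le> 1" using assms by (simp add: sum.delta')
  finally show ?thesis .
qed

lemma levy_level_eq:
  assumes "2 ^ j \<le> n" "n < 2 ^ Suc j"
  shows "levy_level n = j"
proof -
  have "n > 0" by (rule less_le_trans[OF _ assms(1)]) simp
  have "\<lfloor>log 2 (real n)\<rfloor> = int j"
    using floor_log_nat_eq_powr_iff[of 2 n j] assms \<open>n > 0\<close> by simp
  then show ?thesis unfolding levy_level_def by simp
qed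

text \<open>Constancy on a level, with geometric decay in \<open>j\<close>, is what turns the tail
  of the series into a geometric sum.\<close>

lemma levy_coeff_eq:
  assumes "2 ^ j \<le> n" "n < 2 ^ Suc j"
  shows "levy_coeff n = (1 / sqrt 2) ^ j / 2"
proof -
  have "n > 0" by (rule less_le_trans[OF _ assms(1)]) simp
  have "levy_coeff n = 2 powr (- real j / 2 - 1)"
    using \<open>n > 0\<close> levy_level_eq[OF assms] by (simp add: levy_coeff_def)
  also have "\<dots> = (2 powr (- (1 / 2))) powr real j / 2"
    by (simp add: powr_diff powr_powr)
  also have "(2::real) powr (- (1 / 2)) = 1 / sqrt 2"
    unfolding powr_minus_divide by (simp add: powr_half_sqrt)
  finally show ?thesis by (simp add: powr_realpow)
qed

lemma schauder_nonneg: "n \<ge> 1 \<Longrightarrow> 0 \<le> schauder n t"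
  by (simp add: schauder_def Let_def hat_nonneg)

lemma sum_schauder_level_le_1: "(\<Sum>n\<in>{2 ^ j..<2 ^ Suc j}. schauder n t) \<le> 1"
proof -
  \<comment> \<open>Both end points are written as something plus \<open>2 ^ j\<close>, so that the
    index shift to \<open>k = n - 2 ^ j\<close> applies.\<close>
  have "(\<Sum>n\<in>{2 ^ j..<2 ^ Suc j}. schauder n t)
      = (\<Sum>n\<in>{0 + 2 ^ j..<2 ^ j + 2 ^ j}. hat (2 ^ j * t - real (n - 2 ^ j)))"
  proof (rule sum.cong)
    fix n :: nat assume n: "n \<in> {0 + 2 ^ j..<2 ^ j + 2 ^ j}"
    then have "n \<noteq> 0" by auto
    with n show "schauder n t = hat (2 ^ j * t - real (n - 2 ^ j))"
      using levy_level_eq[of j n] by (simp add: schauder_def Let_def)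
  qed auto
  also have "\<dots> = (\<Sum>k\<in>{0..<2 ^ j}. hat (2 ^ j * t - real k))"
    by (subst sum.shift_bounds_nat_ivl) simp
  also have "\<dots> \<le> 1" by (rule sum_hat_shift_le_1) simp
  finally show ?thesis .
qed

text \<open>The Schauder functions of a level are nonnegative with sum at most 1, so they average
  the coefficients. The hypothesis bounds squares since these are what is integrated later.\<close>

lemma levy_approx_increment:
  assumes "\<And>n. n \<in> {2 ^ j..<2 ^ Suc j} \<Longrightarrow> (Z n \<omega>)\<^sup>2 \<le> B"
  shows "\<bar>levy_approx Z (Suc j) t \<omega> - levy_approx Z j t \<omega>\<bar> \<le> (1 / sqrt 2) ^ j / 2 * sqrt B"
proof -
  let ?I = "{2 ^ j..<2 ^ Suc j :: nat}" and ?c = "(1 / sqrt 2) ^ j / 2 :: real"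
  \<comment> \<open>A level is never empty, so \<open>B\<close> dominates some square and is
    nonnegative.\<close>
  have "2 ^ j \<in> ?I" by simp
  from assms[OF this] have B: "B \<ge> 0" by (meson order_trans zero_le_power2)
  have "levy_approx Z (Suc j) t \<omega>
      = levy_approx Z j t \<omega> + (\<Sum>n\<in>?I. levy_coeff n * Z n \<omega> * schauder n t)"
    unfolding levy_approx_def lessThan_atLeast0
    by (rule sum.atLeastLessThan_concat[symmetric]) auto
  then have "\<bar>levy_approx Z (Suc j) t \<omega> - levy_approx Z j t \<omega>\<bar>
      = \<bar>\<Sum>n\<in>?I. levy_coeff n * Z n \<omega> * schauder n t\<bar>" by simp
  also have "\<dots> \<le> (\<Sum>n\<in>?I. \<bar>levy_coeff n * Z n \<omega> * schauder n t\<bar>)" by (rule sum_abs)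
  also have "\<dots> \<le> (\<Sum>n\<in>?I. ?c * sqrt B * schauder n t)"
  proof (rule sum_mono)
    fix n assume n: "n \<in> ?I"
    have "n \<ge> 1" by (rule order_trans[of _ "2 ^ j"]) (use n in auto)
    have "\<bar>levy_coeff n\<bar> = ?c" using levy_coeff_eq[of j n] n by (simp only: atLeastLessThan_iff) simp
    moreover have "\<bar>Z n \<omega>\<bar> \<le> sqrt B" using assms[OF n] by (simp add: real_le_rsqrt)
    ultimately have "\<bar>levy_coeff n * Z n \<omega>\<bar> \<le> ?c * sqrt B"
      unfolding abs_mult by (intro mult_mono) auto
    then show "\<bar>levy_coeff n * Z n \<omega> * schauder n t\<bar> \<le> ?c * sqrt B * schauder n t"
      using schauder_nonneg[OF \<open>n \<ge> 1\<close>, of t]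
      unfolding abs_mult[of _ "schauder n t"] by (simp only: abs_of_nonneg mult_right_mono)
  qed
  also have "\<dots> = ?c * sqrt B * (\<Sum>n\<in>?I. schauder n t)" by (simp add: sum_distrib_left)
  also have "\<dots> \<le> ?c * sqrt B * 1"
    by (intro mult_left_mono sum_schauder_level_le_1) (use B in auto)
  finally show ?thesis by simp
qed

section \<open>The pathwise tail bound\<close>

lemma geometric_sum_le:
  fixes r :: real
  assumes "0 \<le> r" "r < 1"
  shows "(\<Sum>i<n. r ^ i) \<le> 1 / (1 - r)"
  using assms by (simp add: sum_gp_strict divide_right_mono)

text \<open>Telescoping over levels, then Cauchy-Schwarz. The bound is the same for all
  \<open>t\<close>, so it will survive the supremum.\<close>

lemma levy_approx_diff_sq:
  assumes B: "\<And>j n. n \<in> {2 ^ j..<2 ^ Suc j} \<Longrightarrow> (Z n \<omega>)\<^sup>2 \<le> B j"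
  defines "r \<equiv> 1 / sqrt 2"
  shows "(levy_approx Z J t \<omega> - levy_approx Z (J + N) t \<omega>)\<^sup>2
    \<le> r ^ J / 2 / (1 - r) * (\<Sum>i<N. r ^ (J + i) / 2 * B (J + i))"
proof -
  have r: "0 \<le> r" "r < 1" by (auto simp: r_def)
  have B0: "B j \<ge> 0" for j
    using B[of "2 ^ j" j] by simp (meson order_trans zero_le_power2)
  let ?a = "\<lambda>i. r ^ (J + i) / 2"
  let ?L = "\<lambda>j. levy_approx Z j t \<omega>"
  have "\<bar>?L J - ?L (J + N)\<bar> = \<bar>\<Sum>i<N. ?L (J + Suc i) - ?L (J + i)\<bar>"
    by (subst sum_lessThan_telescope[of "\<lambda>i. ?L (J + i)"]) (simp add: abs_minus_commute)
  also have "\<dots> \<le> (\<Sum>i<N. \<bar>?L (J + Suc i) - ?L (J + i)\<bar>)" by (rule sum_abs)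
  also have "\<dots> \<le> (\<Sum>i<N. ?a i * sqrt (B (J + i)))"
    using levy_approx_increment[of _ Z \<omega>, OF B] by (intro sum_mono) (simp add: r_def)
  finally have "(?L J - ?L (J + N))\<^sup>2 \<le> (\<Sum>i<N. ?a i * sqrt (B (J + i)))\<^sup>2"
    by (intro power2_le_iff_abs_le[THEN iffD2]) (use r B0 in \<open>auto intro!: sum_nonneg\<close>)
  \<comment> \<open>Each weight is split into two roots: one Cauchy-Schwarz factor becomes the total
    weight, the other the weighted sum of the \<open>B (J + i)\<close>.\<close>
  also have "(\<Sum>i<N. ?a i * sqrt (B (J + i)))
      = (\<Sum>i<N. sqrt (?a i) * sqrt (?a i * B (J + i)))"
  proof (rule sum.cong)
    fix i
    have "sqrt (?a i) * sqrt (?a i) = ?a i" using r by simp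
    then show "?a i * sqrt (B (J + i)) = sqrt (?a i) * sqrt (?a i * B (J + i))"
      unfolding real_sqrt_mult[of "?a i"] by (metis mult.assoc)
  qed simp
  also have "\<dots>\<^sup>2 \<le> (\<Sum>i<N. (sqrt (?a i))\<^sup>2) * (\<Sum>i<N. (sqrt (?a i * B (J + i)))\<^sup>2)"
    by (rule Cauchy_Schwarz_ineq_sum)
  also have "\<dots> = (\<Sum>i<N. ?a i) * (\<Sum>i<N. ?a i * B (J + i))"
    using r B0 by simp
  also have "\<dots> \<le> r ^ J / 2 / (1 - r) * (\<Sum>i<N. ?a i * B (J + i))"
  proof (rule mult_right_mono)
    have "(\<Sum>i<N. ?a i) = r ^ J / 2 * (\<Sum>i<N. r ^ i)"
      by (simp add: sum_distrib_left power_add)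
    also have "\<dots> \<le> r ^ J / 2 * (1 / (1 - r))"
      by (intro mult_left_mono geometric_sum_le) (use r in auto)
    finally show "(\<Sum>i<N. ?a i) \<le> r ^ J / 2 / (1 - r)" by simp
  qed (use r B0 in \<open>auto intro!: sum_nonneg\<close>)
  finally show ?thesis .
qed

text \<open>A finite bound passes to the supremum through its square root; an infinite bound is
  trivial.\<close>

lemma sup_norm01_sq_le:
  assumes "\<And>t. t \<in> {0..1} \<Longrightarrow> ennreal ((f t)\<^sup>2) \<le> R"
  shows "(sup_norm01 f)\<^sup>2 \<le> R"
proof (cases R)
  case (real r)
  have "sup_norm01 f \<le> ennreal (sqrt r)"
    unfolding sup_norm01_def
  proof (rule SUP_least)
    fix t :: real assume "t \<in> {0..1}"
    then have "(f t)\<^sup>2 \<le> r" using assms[of t] real by simp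
    then show "ennreal \<bar>f t\<bar> \<le> ennreal (sqrt r)"
      by (intro ennreal_leI) (simp add: real_le_rsqrt)
  qed
  then have "(sup_norm01 f)\<^sup>2 \<le> (ennreal (sqrt r))\<^sup>2" by (rule power_mono) simp
  also have "\<dots> = R" using real by (simp add: ennreal_power)
  finally show ?thesis .
qed simp

text \<open>At each \<open>t\<close> the finite-level estimate passes to the limit in
  \<open>N\<close>. The series on the right is taken in \<open>ennreal\<close>, so it dominates its
  partial sums even if it diverges.\<close>

lemma sup_norm01_levy_tail:
  assumes B: "\<And>j n. n \<in> {2 ^ j..<2 ^ Suc j} \<Longrightarrow> (Z n \<omega>)\<^sup>2 \<le> B j"
    and lim: "uniform_limit {0..1} (\<lambda>N t. levy_approx Z N t \<omega>) w sequentially"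
  defines "r \<equiv> 1 / sqrt 2"
  shows "(sup_norm01 (\<lambda>t. levy_approx Z J t \<omega> - w t))\<^sup>2
    \<le> ennreal (r ^ J / 2 / (1 - r)) * (\<Sum>i. ennreal (r ^ (J + i) / 2 * B (J + i)))"
    (is "_ \<le> ?R")
proof (rule sup_norm01_sq_le)
  fix t :: real assume t: "t \<in> {0..1}"
  have r: "0 \<le> r" "r < 1" by (auto simp: r_def)
  have B0: "B j \<ge> 0" for j
    using B[of "2 ^ j" j] by simp (meson order_trans zero_le_power2)
  have "(\<lambda>N. levy_approx Z N t \<omega>) \<longlonglongrightarrow> w t"
    using tendsto_uniform_limitI[OF lim t] .
  then have "(\<lambda>N. levy_approx Z (J + N) t \<omega>) \<longlonglongrightarrow> w t"
    using LIMSEQ_ignore_initial_segment[of _ "w t" J] by (simp add: add.commute)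
  then have "(\<lambda>N. ennreal ((levy_approx Z J t \<omega> - levy_approx Z (J + N) t \<omega>)\<^sup>2))
      \<longlonglongrightarrow> ennreal ((levy_approx Z J t \<omega> - w t)\<^sup>2)"
    by (intro tendsto_intros)
  then show "ennreal ((levy_approx Z J t \<omega> - w t)\<^sup>2) \<le> ?R"
  proof (rule LIMSEQ_le_const2, intro exI allI impI)
    fix N
    have "ennreal ((levy_approx Z J t \<omega> - levy_approx Z (J + N) t \<omega>)\<^sup>2)
        \<le> ennreal (r ^ J / 2 / (1 - r) * (\<Sum>i<N. r ^ (J + i) / 2 * B (J + i)))"
      unfolding r_def by (intro ennreal_leI levy_approx_diff_sq B)
    also have "\<dots> = ennreal (r ^ J / 2 / (1 - r)) * (\<Sum>i<N. ennreal (r ^ (J + i) / 2 * B (J + i)))"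
      using r B0 by (subst ennreal_mult) (auto simp: sum_ennreal intro!: sum_nonneg)
    also have "\<dots> \<le> ?R"
      by (intro mult_left_mono sum_le_suminf) auto
    finally show "ennreal ((levy_approx Z J t \<omega> - levy_approx Z (J + N) t \<omega>)\<^sup>2) \<le> ?R" .
  qed
qed

section \<open>Maxima of squared Gaussians\<close>

text \<open>The factor \<open>exp (3 / 8 * x\<^sup>2)\<close> turns the standard normal density into
  twice the density with standard deviation 2. The rate 3/8 is chosen so that the mean is 2, which
  makes the sum over level \<open>j\<close> have mean \<open>2 ^ Suc j\<close>.\<close>

lemma nn_integral_exp_std_normal_sq:
  assumes "distributed M lborel X std_normal_density"
  shows "(\<integral>\<^sup>+ \<omega>. ennreal (exp (3 / 8 * (X \<omega>)\<^sup>2)) \<partial>M) = 2"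
proof -
  have "(\<integral>\<^sup>+ \<omega>. ennreal (exp (3 / 8 * (X \<omega>)\<^sup>2)) \<partial>M)
      = (\<integral>\<^sup>+ x. ennreal (std_normal_density x) * ennreal (exp (3 / 8 * x\<^sup>2)) \<partial>lborel)"
    by (rule distributed_nn_integral[OF assms, symmetric]) simp
  also have "\<dots> = (\<integral>\<^sup>+ x. 2 * ennreal (normal_density 0 2 x) \<partial>lborel)"
  proof (rule nn_integral_cong)
    fix x :: real
    have "std_normal_density x * exp (3 / 8 * x\<^sup>2) = 2 * normal_density 0 2 x"
    proof -
      have "exp (- x\<^sup>2 / 2) * exp (3 / 8 * x\<^sup>2) = exp (- x\<^sup>2 / 8)"
        by (simp flip: exp_add)
      moreover have "sqrt (8 * pi) = 2 * sqrt (2 * pi)"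
        using real_sqrt_mult[of 4 "2 * pi"] by simp
      ultimately show ?thesis
        by (simp add: normal_density_def field_simps)
    qed
    then have "ennreal (std_normal_density x * exp (3 / 8 * x\<^sup>2)) = ennreal (2 * normal_density 0 2 x)"
      by simp
    then show "ennreal (std_normal_density x) * ennreal (exp (3 / 8 * x\<^sup>2))
        = 2 * ennreal (normal_density 0 2 x)"
      by (simp add: ennreal_mult)
  qed
  also have "\<dots> = 2 * (\<integral>\<^sup>+ x. ennreal (normal_density 0 2 x) \<partial>lborel)"
    by (rule nn_integral_cmult) simp
  also have "(\<integral>\<^sup>+ x. ennreal (normal_density 0 2 x) \<partial>lborel) = ennreal (\<integral>x. normal_density 0 2 x \<partial>lborel)"
    by (rule nn_integral_eq_integral) auto
  finally show ?thesis by simp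
qed

text \<open>A smooth majorant of the squares \<open>(Z n \<omega>)\<^sup>2\<close> of level \<open>j\<close>: the tangent to the logarithm
  at \<open>2 * 2 ^ j\<close>, the mean of the sum of exponentials, which makes the mean of the majorant exact.\<close>

definition level_sq_bound :: "(nat \<Rightarrow> 'a \<Rightarrow> real) \<Rightarrow> nat \<Rightarrow> 'a \<Rightarrow> real" where
  "level_sq_bound Z j \<omega> = 8 / 3 *
     ((\<Sum>n\<in>{2 ^ j..<2 ^ Suc j}. exp (3 / 8 * (Z n \<omega>)\<^sup>2)) / 2 ^ Suc j - 1 + real (Suc j) * ln 2)"

text \<open>One exponential is at most the sum over its level; taking logarithms and bounding
  \<open>ln\<close> by its tangent gives the claim.\<close>

lemma level_sq_bound:
  assumes "n \<in> {2 ^ j..<2 ^ Suc j}"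
  shows "(Z n \<omega>)\<^sup>2 \<le> level_sq_bound Z j \<omega>"
proof -
  let ?S = "\<Sum>n\<in>{2 ^ j..<2 ^ Suc j}. exp (3 / 8 * (Z n \<omega>)\<^sup>2)"
  have le: "exp (3 / 8 * (Z n \<omega>)\<^sup>2) \<le> ?S"
    by (rule member_le_sum[OF assms]) auto
  then have pos: "?S > 0" by (meson exp_gt_zero less_le_trans)
  have "3 / 8 * (Z n \<omega>)\<^sup>2 \<le> ln ?S"
    using le pos by (simp only: ln_ge_iff)
  moreover have "ln (?S / 2 ^ Suc j) \<le> ?S / 2 ^ Suc j - 1"
    by (rule ln_le_minus_one) (use pos in simp)
  moreover have "ln (?S / 2 ^ Suc j) = ln ?S - real (Suc j) * ln 2"
    using pos by (subst ln_div) (simp_all add: ln_realpow del: power_Suc)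
  ultimately have "3 / 8 * (Z n \<omega>)\<^sup>2 \<le> ?S / 2 ^ Suc j - 1 + real (Suc j) * ln 2" by linarith
  then have "8 / 3 * (3 / 8 * (Z n \<omega>)\<^sup>2)
      \<le> 8 / 3 * (?S / 2 ^ Suc j - 1 + real (Suc j) * ln 2)" by (rule mult_left_mono) simp
  then show ?thesis unfolding level_sq_bound_def by simp
qed

lemma level_sq_bound_nonneg: "0 \<le> level_sq_bound Z j \<omega>"
  using level_sq_bound[of "2 ^ j" j Z \<omega>] by simp (meson order_trans zero_le_power2)

text \<open>By linearity the normalised sum of exponentials has mean 1 and cancels the
  \<open>- 1\<close>, leaving only the logarithmic term.\<close>

lemma (in prob_space) nn_integral_level_sq_bound:
  assumes Z: "\<And>n. distributed M lborel (Z n) std_normal_density"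
  shows "(\<integral>\<^sup>+ \<omega>. ennreal (level_sq_bound Z j \<omega>) \<partial>M) = ennreal (8 / 3 * ln 2 * real (Suc j))"
proof -
  have Zm[measurable]: "Z n \<in> borel_measurable M" for n
    using distributed_measurable[OF Z] by simp
  \<comment> \<open>The majorant contains a subtraction, so linearity is used for the Bochner
    integral; its nonnegativity leads back to \<open>ennreal\<close> at the end.\<close>
  have ex: "has_bochner_integral M (\<lambda>\<omega>. exp (3 / 8 * (Z n \<omega>)\<^sup>2)) 2" for n
    by (rule has_bochner_integral_nn_integral)
      (use nn_integral_exp_std_normal_sq[OF Z] in auto)
  let ?S = "\<lambda>\<omega>. \<Sum>n\<in>{2 ^ j..<2 ^ Suc j}. exp (3 / 8 * (Z n \<omega>)\<^sup>2)"
  have S: "has_bochner_integral M ?S (2 ^ Suc j)"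
    using has_bochner_integral_sum[of "{2 ^ j..<2 ^ Suc j :: nat}" M "\<lambda>n \<omega>. exp (3 / 8 * (Z n \<omega>)\<^sup>2)", OF ex]
    by (simp add: mult.commute)
  then have I: "integrable M ?S" "integral\<^sup>L M ?S = 2 ^ Suc j"
    by (auto simp: has_bochner_integral_iff)
  have "integrable M (level_sq_bound Z j)"
    unfolding level_sq_bound_def using I(1) by (auto simp del: power_Suc)
  moreover have "integral\<^sup>L M (level_sq_bound Z j) = 8 / 3 * ln 2 * real (Suc j)"
    unfolding level_sq_bound_def using I by (simp add: prob_space del: power_Suc)
  ultimately show ?thesis
    by (subst nn_integral_eq_integral) (auto simp: level_sq_bound_nonneg)
qed

section \<open>The mean square error\<close>

lemma inverse_sqrt2_complement: "1 / (1 - 1 / sqrt 2) = 2 + sqrt 2"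
proof -
  have "(1 - 1 / sqrt 2) * (2 + sqrt 2) = 1" by (simp add: field_simps)
  then show ?thesis by (simp add: field_simps)
qed

text \<open>The linear factor splits as \<open>J\<close> plus \<open>Suc i\<close>: a geometric
  series and the derivative of one.\<close>

lemma sums_geometric_linear:
  fixes r :: real
  assumes "0 \<le> r" "r < 1"
  shows "(\<lambda>i. r ^ i * real (Suc (J + i))) sums (real J / (1 - r) + 1 / (1 - r)\<^sup>2)"
proof -
  have "(\<lambda>i. real J * r ^ i) sums (real J * (1 / (1 - r)))"
    by (intro sums_mult geometric_sums) (use assms in auto)
  moreover have "(\<lambda>i. real (Suc i) * r ^ i) sums (1 / (1 - r)\<^sup>2)"
    using geometric_deriv_sums[of r] assms by simp
  ultimately have "(\<lambda>i. real J * r ^ i + real (Suc i) * r ^ i) sums (real J * (1 / (1 - r)) + 1 / (1 - r)\<^sup>2)"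
    by (rule sums_add)
  then show ?thesis by (simp add: algebra_simps)
qed

text \<open>The pathwise tail bound is integrated term by term, and the known level means leave an
  arithmetic-geometric series.\<close>

lemma (in prob_space) levy_mean_square_error:
  assumes Z: "\<And>n. distributed M lborel (Z n) std_normal_density"
    and lim: "AE \<omega> in M. uniform_limit {0..1} (\<lambda>N t. levy_approx Z N t \<omega>) (\<lambda>t. W t \<omega>) sequentially"
  shows "(\<integral>\<^sup>+ \<omega>. (sup_norm01 (\<lambda>t. levy_approx Z J t \<omega> - W t \<omega>))\<^sup>2 \<partial>M)
    \<le> ennreal (2 / 3 * ln 2 * (2 + sqrt 2)\<^sup>2 * (real J + 2 + sqrt 2) / 2 ^ J)"
proof -
  define r :: real where "r = 1 / sqrt 2"
  define q :: real where "q = 2 + sqrt 2"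
  have r: "0 \<le> r" "r < 1" by (auto simp: r_def)
  have q: "1 / (1 - r) = q" unfolding r_def q_def by (rule inverse_sqrt2_complement)
  have Zm[measurable]: "Z n \<in> borel_measurable M" for n
    using distributed_measurable[OF Z] by simp
  have Bm[measurable]: "level_sq_bound Z j \<in> borel_measurable M" for j
    unfolding level_sq_bound_def by measurable
  let ?A = "r ^ J / 2 / (1 - r)"
  \<comment> \<open>\<open>?K\<close> collects the part of the \<open>i\<close>-th weighted mean
    that does not depend on \<open>i\<close>.\<close>
  let ?K = "8 / 3 * ln 2 * (r ^ J / 2)"
  have "(\<integral>\<^sup>+ \<omega>. (sup_norm01 (\<lambda>t. levy_approx Z J t \<omega> - W t \<omega>))\<^sup>2 \<partial>M)
      \<le> (\<integral>\<^sup>+ \<omega>. ennreal ?A * (\<Sum>i. ennreal (r ^ (J + i) / 2 * level_sq_bound Z (J + i) \<omega>)) \<partial>M)"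
  proof (rule nn_integral_mono_AE)
    show "AE \<omega> in M. (sup_norm01 (\<lambda>t. levy_approx Z J t \<omega> - W t \<omega>))\<^sup>2
        \<le> ennreal ?A * (\<Sum>i. ennreal (r ^ (J + i) / 2 * level_sq_bound Z (J + i) \<omega>))"
      using lim unfolding r_def
      by eventually_elim (rule sup_norm01_levy_tail[OF level_sq_bound])
  qed
  also have "\<dots> = ennreal ?A * (\<Sum>i. \<integral>\<^sup>+ \<omega>. ennreal (r ^ (J + i) / 2 * level_sq_bound Z (J + i) \<omega>) \<partial>M)"
    by (simp add: nn_integral_cmult nn_integral_suminf)
  also have "(\<lambda>i. \<integral>\<^sup>+ \<omega>. ennreal (r ^ (J + i) / 2 * level_sq_bound Z (J + i) \<omega>) \<partial>M)
      = (\<lambda>i. ennreal (?K * (r ^ i * real (Suc (J + i)))))"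
  proof
    fix i
    have "(\<integral>\<^sup>+ \<omega>. ennreal (r ^ (J + i) / 2 * level_sq_bound Z (J + i) \<omega>) \<partial>M)
        = ennreal (r ^ (J + i) / 2) * (\<integral>\<^sup>+ \<omega>. ennreal (level_sq_bound Z (J + i) \<omega>) \<partial>M)"
      using r by (subst nn_integral_cmult[symmetric], measurable)
        (intro nn_integral_cong ennreal_mult, auto simp: level_sq_bound_nonneg)
    also have "\<dots> = ennreal (r ^ (J + i) / 2 * (8 / 3 * ln 2 * real (Suc (J + i))))"
      using r unfolding nn_integral_level_sq_bound[OF Z] by (subst ennreal_mult) auto
    also have "r ^ (J + i) / 2 * (8 / 3 * ln 2 * real (Suc (J + i))) = ?K * (r ^ i * real (Suc (J + i)))"
      by (simp add: power_add)
    finally show "(\<integral>\<^sup>+ \<omega>. ennreal (r ^ (J + i) / 2 * level_sq_bound Z (J + i) \<omega>) \<partial>M)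
        = ennreal (?K * (r ^ i * real (Suc (J + i))))" .
  qed
  also have "(\<Sum>i. ennreal (?K * (r ^ i * real (Suc (J + i)))))
      = ennreal (?K * (real J / (1 - r) + 1 / (1 - r)\<^sup>2))"
  proof -
    have "(\<lambda>i. ?K * (r ^ i * real (Suc (J + i)))) sums (?K * (real J / (1 - r) + 1 / (1 - r)\<^sup>2))"
      by (intro sums_mult sums_geometric_linear r)
    then show ?thesis using r by (intro suminf_ennreal_eq) auto
  qed
  also have "ennreal ?A * \<dots> = ennreal (?A * (?K * (real J / (1 - r) + 1 / (1 - r)\<^sup>2)))"
    using r by (intro ennreal_mult[symmetric]) auto
  also have "?A * (?K * (real J / (1 - r) + 1 / (1 - r)\<^sup>2)) = 2 / 3 * ln 2 * q\<^sup>2 * (real J + q) / 2 ^ J"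
  proof -
    have eqs: "?A = r ^ J / 2 * q" "real J / (1 - r) = real J * q" "1 / (1 - r)\<^sup>2 = q\<^sup>2"
      using q by (simp_all flip: q add: power_divide)
    \<comment> \<open>One factor \<open>r ^ J\<close> comes from the total weight and one from the
      weighted means; together they give the decay \<open>1 / 2 ^ J\<close>.\<close>
    have "r\<^sup>2 = 1 / 2" by (simp add: r_def power_divide)
    then have rJ: "r ^ J * r ^ J = 1 / 2 ^ J"
      by (metis power2_eq_square power_mult_distrib power_one_over)
    have "?A * (?K * (real J / (1 - r) + 1 / (1 - r)\<^sup>2))
        = 2 / 3 * ln 2 * q\<^sup>2 * (real J + q) * (r ^ J * r ^ J)"
      unfolding eqs by (simp add: power2_eq_square field_simps)
    then show ?thesis unfolding rJ by simp
  qed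
  finally show ?thesis by (simp add: q_def add.assoc)
qed

section \<open>Lower bounds on the constants\<close>

text \<open>\<open>C_a\<close> decreases in \<open>ln 2\<close>, so the upper bound 25/36 for
  \<open>ln 2\<close> gives 2.88 times the square of 1.72, just above 8.5.\<close>

lemma C_a_sq_ge: "C_a\<^sup>2 \<ge> 8.5"
proof -
  have l: "0 < ln (2::real)" "ln (2::real) \<le> 25 / 36"
    using ln2_le_25_over_36 by auto
  have "36 / 25 \<le> 1 / ln (2::real)" using l by (simp add: field_simps)
  then have "1 + 18 / 25 \<le> 1 + 1 / (2 * ln (2::real))" and "72 / 25 \<le> 2 / ln (2::real)"
    by (simp_all add: field_simps)
  then have "72 / 25 * (1 + 18 / 25)\<^sup>2 \<le> 2 / ln 2 * (1 + 1 / (2 * ln (2::real)))\<^sup>2"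
    using l by (intro mult_mono power_mono) auto
  also have "\<dots> = C_a\<^sup>2" using l by (simp add: C_a_def power_mult_distrib)
  finally show ?thesis by (simp add: power2_eq_square)
qed

lemma C_a_nonneg: "0 \<le> C_a"
  unfolding C_a_def by (intro mult_nonneg_nonneg) auto

lemma levy_const_4_sq_ge: "(levy_const 4)\<^sup>2 \<ge> 1"
  by (simp add: levy_const_def add_nonneg_nonneg)

text \<open>Whichever of \<open>\<alpha> \<ge> d\<close> and \<open>\<alpha> < d\<close> holds, one of the two summands added to 1 is large.\<close>

lemma levy_const_sq_ge:
  assumes "J \<ge> 1" "J \<noteq> 4" "0 < d" "d * real J \<le> 1"
    and d: "d * ((1 + d)\<^sup>2 * real J * 2 ^ (J + 1)) \<le> 4"
  shows "(levy_const J)\<^sup>2 \<ge> 1 + d" "levy_const J \<ge> 0"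
proof -
  define g :: "real \<Rightarrow> real" where "g \<alpha> =
       1 + \<alpha> + 2 / ((1 + \<alpha>) powr (1/2) * ln 2 powr (5/2))
         * (1 / ((1 + \<alpha>) * real J) + 3 / (2 * ln 2 * ((1 + \<alpha>) * real J) powr (3/2)))
         * 2 powr (- (1 + \<alpha>) * real J)" for \<alpha>
  have l: "0 < ln (2::real)" "ln (2::real) \<le> 25 / 36"
    using ln2_le_25_over_36 by auto
  have "g \<alpha> \<ge> 1 + d" if \<alpha>: "\<alpha> > 0" for \<alpha>
  proof (cases "\<alpha> \<ge> d")
    case True
    then show ?thesis using \<alpha> l unfolding g_def by (simp add: add_increasing2)
  next
    case False
    \<comment> \<open>The base is below 1, so lowering the exponent to 2 enlarges the power, and the
      square of 25/36 is still below 1/2.\<close>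
    have "ln (2::real) powr (5/2) \<le> (ln 2) powr 2"
      using l by (intro powr_mono') auto
    also have "\<dots> \<le> 1 / 2"
      using l power_mono[of "ln 2" "25/36 :: real" 2] by (simp add: power_divide)
    finally have l2: "ln (2::real) powr (5/2) \<le> 1 / 2" .
    have "(1 + \<alpha>) powr (1/2) \<le> (1 + \<alpha>) powr 1"
      using \<alpha> by (intro powr_mono) auto
    then have s: "(1 + \<alpha>) powr (1/2) \<le> 1 + d" using \<alpha> False by simp
    have p: "(1 + \<alpha>) powr (1/2) * ln 2 powr (5/2) \<le> (1 + d) * (1 / 2)"
      using s l2 assms(3) by (intro mult_mono) auto
    have "4 / (1 + d) = 2 / ((1 + d) * (1 / 2))" by simp
    also have "\<dots> \<le> 2 / ((1 + \<alpha>) powr (1/2) * ln 2 powr (5/2))"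
      by (rule divide_left_mono[OF p]) (use \<alpha> l assms(3) in auto)
    finally have f1: "4 / (1 + d) \<le> 2 / ((1 + \<alpha>) powr (1/2) * ln 2 powr (5/2))" .
    have "1 / ((1 + d) * real J) \<le> 1 / ((1 + \<alpha>) * real J)"
      using \<alpha> False assms(1) by (intro divide_left_mono mult_right_mono) auto
    also have "\<dots> \<le> 1 / ((1 + \<alpha>) * real J) + 3 / (2 * ln 2 * ((1 + \<alpha>) * real J) powr (3/2))"
      using l by simp
    finally have f2: "1 / ((1 + d) * real J)
        \<le> 1 / ((1 + \<alpha>) * real J) + 3 / (2 * ln 2 * ((1 + \<alpha>) * real J) powr (3/2))" .
    \<comment> \<open>Since \<open>d * real J \<le> 1\<close>, the exponent
      \<open>(1 + \<alpha>) * real J\<close> is at most \<open>J + 1\<close>.\<close>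
    have "\<alpha> * real J \<le> d * real J" using False by (intro mult_right_mono) auto
    then have "- real (J + 1) \<le> - (1 + \<alpha>) * real J"
      using assms(4) by (simp add: algebra_simps)
    then have "2 powr (- real (J + 1)) \<le> 2 powr (- (1 + \<alpha>) * real J)"
      by (intro powr_mono) auto
    also have "2 powr (- real (J + 1)) = 1 / 2 ^ (J + 1)"
      unfolding powr_minus_divide using powr_realpow[of 2 "J + 1"] by simp
    finally have f3: "1 / 2 ^ (J + 1) \<le> 2 powr (- (1 + \<alpha>) * real J)" .
    \<comment> \<open>The hypothesis \<open>d\<close> says exactly that the product of the lower
      bounds in \<open>f1\<close>, \<open>f2\<close> and \<open>f3\<close> is at least
      \<open>d\<close>.\<close>
    have "0 < (1 + d)\<^sup>2 * real J * 2 ^ (J + 1)" using assms(1,3) by simp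
    then have "d \<le> 4 / ((1 + d)\<^sup>2 * real J * 2 ^ (J + 1))"
      using d by (simp only: le_divide_eq if_True)
    also have "\<dots> = 4 / (1 + d) * (1 / ((1 + d) * real J)) * (1 / 2 ^ (J + 1))"
      by (simp add: power2_eq_square)
    also have "\<dots> \<le> 2 / ((1 + \<alpha>) powr (1/2) * ln 2 powr (5/2))
         * (1 / ((1 + \<alpha>) * real J) + 3 / (2 * ln 2 * ((1 + \<alpha>) * real J) powr (3/2)))
         * 2 powr (- (1 + \<alpha>) * real J)"
      using \<alpha> l assms(3) by (intro mult_mono f1 f2 f3) auto
    finally show ?thesis using \<alpha> unfolding g_def by linarith
  qed
  then have "1 + d \<le> (INF \<alpha>\<in>{0<..}. g \<alpha>)"
    by (intro cINF_greatest) auto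
  moreover have "levy_const J = sqrt (INF \<alpha>\<in>{0<..}. g \<alpha>)"
    using assms(2) by (simp add: levy_const_def g_def)
  ultimately show "(levy_const J)\<^sup>2 \<ge> 1 + d" "levy_const J \<ge> 0" using assms(3) by simp_all
qed

text \<open>\<open>sqrt\<close> is extended to negative reals as an odd function, so the sign
  depends on the infimum. The value 1/100 is small enough for \<open>J\<close> up to 3.\<close>

lemma levy_const_nonneg:
  assumes "J \<ge> 1"
  shows "0 \<le> levy_const (min J 4)"
proof -
  consider "J = 1" | "J = 2" | "J = 3" | "J \<ge> 4" using assms by linarith
  then show ?thesis
  proof cases
    case 1
    then show ?thesis using levy_const_sq_ge(2)[of 1 "1/100"] by (simp add: power2_eq_square)
  next
    case 2
    then show ?thesis using levy_const_sq_ge(2)[of 2 "1/100"] by (simp add: power2_eq_square)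
  next
    case 3
    then show ?thesis using levy_const_sq_ge(2)[of 3 "1/100"] by (simp add: power2_eq_square)
  next
    case 4
    then show ?thesis by (simp add: levy_const_def min_absorb2 add_nonneg_nonneg)
  qed
qed

text \<open>With rational bounds for \<open>sqrt 2\<close>, \<open>ln 2\<close> and
  \<open>C_a\<close>, only a comparison of two linear functions of \<open>J\<close> remains.\<close>

lemma mean_square_constants:
  assumes "J \<ge> 1"
  shows "2 / 3 * ln 2 * (2 + sqrt 2)\<^sup>2 * (real J + 2 + sqrt 2)
    \<le> C_a\<^sup>2 * (levy_const (min J 4))\<^sup>2 * (real J + 1)"
proof -
  have s: "sqrt 2 \<le> 1.4143" by (rule real_le_lsqrt) (auto simp: power2_eq_square)
  have "2 / 3 * ln 2 * (2 + sqrt 2)\<^sup>2 \<le> 2 / 3 * (25 / 36) * (3.4143)\<^sup>2"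
    using s ln2_le_25_over_36 by (intro mult_mono power_mono) auto
  also have "\<dots> \<le> 5.4" by (simp add: power2_eq_square)
  finally have "2 / 3 * ln 2 * (2 + sqrt 2)\<^sup>2 * (real J + 2 + sqrt 2) \<le> 5.4 * (real J + 3.4143)"
    using s by (intro mult_mono) auto
  also consider "J = 1" | "J = 2" | "J = 3" | "J \<ge> 4" using assms by linarith
  then have "5.4 * (real J + 3.4143) \<le> 8.5 * (levy_const (min J 4))\<^sup>2 * (real J + 1)"
  proof cases
    \<comment> \<open>For \<open>J\<close> equal to 1, 2, 3 the comparison needs \<open>d\<close> of
      at least about 0.402, 0.147 and 0.019. The values 0.45, 0.16 and 0.05 suffice and still meet
      the condition of \<open>levy_const_sq_ge\<close>.\<close>
    case 1
    then show ?thesis using levy_const_sq_ge(1)[of 1 "45/100"] by (simp add: power2_eq_square)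
  next
    case 2
    then show ?thesis using levy_const_sq_ge(1)[of 2 "16/100"] by (simp add: power2_eq_square)
  next
    case 3
    then show ?thesis using levy_const_sq_ge(1)[of 3 "5/100"] by (simp add: power2_eq_square)
  next
    case 4
    \<comment> \<open>With the constant replaced by 1, the larger slope 8.5 wins from about
      \<open>J = 3.21\<close> on, hence for all \<open>J\<close> from 4.\<close>
    have "5.4 * (real J + 3.4143) \<le> 8.5 * 1 * (real J + 1)" using 4 by simp
    also have "\<dots> \<le> 8.5 * (levy_const 4)\<^sup>2 * (real J + 1)"
      using levy_const_4_sq_ge by (intro mult_right_mono mult_left_mono) auto
    finally show ?thesis using 4 by (simp add: min_absorb2)
  qed
  also have "\<dots> \<le> C_a\<^sup>2 * (levy_const (min J 4))\<^sup>2 * (real J + 1)"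
    by (intro mult_right_mono C_a_sq_ge) auto
  finally show ?thesis .
qed

section \<open>From the mean square error to its square root\<close>

theorem corollary1:
  fixes M :: "'a measure"
    and Z :: "nat \<Rightarrow> 'a \<Rightarrow> real"
    and W :: "real \<Rightarrow> 'a \<Rightarrow> real"
    and J :: nat
  assumes "prob_space M"
    and "prob_space.indep_vars M (\<lambda>_. borel) Z UNIV"
    and "\<And>n. distributed M lborel (Z n) std_normal_density"
    and "AE \<omega> in M. uniform_limit {0..1} (\<lambda>N t. levy_approx Z N t \<omega>) (\<lambda>t. W t \<omega>) sequentially"
    and "J \<ge> 1"
  shows "(\<integral>\<^sup>+ \<omega>. (sup_norm01 (\<lambda>t. levy_approx Z J t \<omega> - W t \<omega>))\<^sup>2 \<partial>M) < \<infinity>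
    \<and> sqrt (enn2real (\<integral>\<^sup>+ \<omega>. (sup_norm01 (\<lambda>t. levy_approx Z J t \<omega> - W t \<omega>))\<^sup>2 \<partial>M))
           \<le> C_a * levy_const (min J 4) * sqrt (real J + 1) * 2 powr (- real J / 2)"
proof -
  interpret prob_space M by fact
  let ?I = "\<integral>\<^sup>+ \<omega>. (sup_norm01 (\<lambda>t. levy_approx Z J t \<omega> - W t \<omega>))\<^sup>2 \<partial>M"
  let ?b = "2 / 3 * ln 2 * (2 + sqrt 2)\<^sup>2 * (real J + 2 + sqrt 2) / 2 ^ J"
  let ?c = "C_a * levy_const (min J 4) * sqrt (real J + 1) * 2 powr (- real J / 2)"
  have I: "?I \<le> ennreal ?b" by (rule levy_mean_square_error[OF assms(3,4)])
  then have "enn2real ?I \<le> ?b"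
    by (intro enn2real_leI) auto
  also have "\<dots> \<le> C_a\<^sup>2 * (levy_const (min J 4))\<^sup>2 * (real J + 1) / 2 ^ J"
    by (intro divide_right_mono mean_square_constants assms(5)) auto
  also have "\<dots> = ?c\<^sup>2"
  proof -
    have "(2 powr (- real J / 2))\<^sup>2 = (2::real) powr (- real J)"
      by (simp add: power2_eq_square flip: powr_add)
    also have "\<dots> = 1 / 2 ^ J" by (simp add: powr_minus_divide powr_realpow)
    finally show ?thesis by (simp add: power_mult_distrib)
  qed
  finally have "sqrt (enn2real ?I) \<le> sqrt (?c\<^sup>2)" by (rule real_sqrt_le_mono)
  then have "sqrt (enn2real ?I) \<le> \<bar>?c\<bar>" by (simp only: real_sqrt_abs)
  moreover have "0 \<le> ?c"
    using C_a_nonneg levy_const_nonneg assms(5) by simp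
  \<comment> \<open>\<open>enn2real\<close> sends infinity to 0, so the root estimate alone would
    not exclude an infinite integral.\<close>
  moreover have "?I < \<infinity>"
    using I by (rule le_less_trans) simp
  ultimately show ?thesis by (simp only: abs_of_nonneg)
qed

end
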